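(* Let $(X,\tau,\mathsf d)$ be an extended metric-topological space. A net $\{\mu_j\}_{j\in J}\subset\mathcal P(X)$ weakly converges to $\mu\in\mathcal P(X)$ if and only if $$\lim_{j\in J}\int f\,d\mu_j=\int f\,d\mu\qquad\text{for every }f\in\mathrm{Lip}_b(X,\tau,\mathsf d).$$ In particular, if $\{\mu_j\}_{j\in J}$ converges to $\mu$ with respect to $W_{\mathsf d}$, then it also converges to $\mu$ with respect to the weak topology induced by $C_b(X)$.
   Context: An extended metric space $(X,\mathsf d)$ is a set with a symmetric $\mathsf d:X\times X\to[0,\infty]$ satisfying the triangle inequality and $\mathsf d(x,y)=0$ iff $x=y$; for a semidistance the last condition is weakened to $\mathsf d(x,x)=0$. For a Hausdorff topology $\tau$ on $X$, $\mathrm{Lip}_b(X,\tau,\mathsf d)$ is the set of bounded, $\mathsf d$-Lipschitz, $\tau$-continuous functions $f:X\to\mathbb R$. $(X,\tau,\mathsf d)$ is an extended metric-topological space if (a) there are $(\tau\times\tau)$-continuous bounded semidistances $\mathsf d_i:X\times X\to[0,\infty)$, $i\in I$, with $\mathsf d=\sup_i\mathsf d_i$; (b) $\tau$ is generated by $\mathrm{Lip}_b(X,\tau,\mathsf d)$. $\mathcal P(X)$ is the set of Radon probability measures on the Borel sets of $\tau$ (for every Borel $B$ and $\epsilon>0$ there is a compact $K\subset B$ with $\mu(B\setminus K)<\epsilon$). Weak convergence is convergence in duality with $C_b(X)$, the bounded $\tau$-continuous real functions. $W_{\mathsf d}^2(\mu,\nu)=\inf\int_{X\times X}\mathsf d^2\,d\boldsymbol\pi$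 over Radon probability measures $\boldsymbol\pi$ on $X\times X$ with marginals $\mu,\nu$; $W_{\mathsf d}$ takes values in $[0,\infty]$. *)

theory Defs
  imports "HOL-Probability.Probability"
begin

text \<open>The space is the carrier \<open>topspace T\<close> of an abstract topology; distances are total functions
  on the type and are constrained only on that carrier.\<close>

definition semidistance_on :: "'a set \<Rightarrow> ('a \<Rightarrow> 'a \<Rightarrow> ennreal) \<Rightarrow> bool" where
  "semidistance_on X d \<longleftrightarrow>
     (\<forall>x\<in>X. d x x = 0) \<and>
     (\<forall>x\<in>X. \<forall>y\<in>X. d x y = d y x) \<and>
     (\<forall>x\<in>X. \<forall>y\<in>X. \<forall>z\<in>X. d x z \<le> d x y + d y z)"

definition extended_metric_on :: "'a set \<Rightarrow> ('a \<Rightarrow> 'a \<Rightarrow> ennreal) \<Rightarrow> bool" where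
  "extended_metric_on X d \<longleftrightarrow>
     semidistance_on X d \<and> (\<forall>x\<in>X. \<forall>y\<in>X. d x y = 0 \<longleftrightarrow> x = y)"

definition continuous_bounded_semidistance :: "'a topology \<Rightarrow> ('a \<Rightarrow> 'a \<Rightarrow> real) \<Rightarrow> bool" where
  "continuous_bounded_semidistance T \<delta> \<longleftrightarrow>
     (\<forall>x\<in>topspace T. \<forall>y\<in>topspace T. 0 \<le> \<delta> x y) \<and>
     semidistance_on (topspace T) (\<lambda>x y. ennreal (\<delta> x y)) \<and>
     (\<exists>C. \<forall>x\<in>topspace T. \<forall>y\<in>topspace T. \<delta> x y \<le> C) \<and>
     continuous_map (prod_topology T T) euclideanreal (\<lambda>(x, y). \<delta> x y)"

definition Cb :: "'a topology \<Rightarrow> ('a \<Rightarrow> real) set" where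
  "Cb T = {f. continuous_map T euclideanreal f \<and> bounded (f ` topspace T)}"

definition Lipb :: "'a topology \<Rightarrow> ('a \<Rightarrow> 'a \<Rightarrow> ennreal) \<Rightarrow> ('a \<Rightarrow> real) set" where
  "Lipb T d = {f \<in> Cb T. \<exists>L\<ge>0. \<forall>x\<in>topspace T. \<forall>y\<in>topspace T.
     ennreal \<bar>f x - f y\<bar> \<le> ennreal L * d x y}"

text \<open>The family of semidistances is a set indexed by itself, which avoids an existentially
  quantified index type. The last conjunct says that \<open>T\<close> is the initial topology of \<open>Lipb T d\<close>.\<close>

definition extended_metric_topological_space ::
    "'a topology \<Rightarrow> ('a \<Rightarrow> 'a \<Rightarrow> ennreal) \<Rightarrow> bool" where
  "extended_metric_topological_space T d \<longleftrightarrow>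
     Hausdorff_space T \<and>
     extended_metric_on (topspace T) d \<and>
     (\<exists>D. (\<forall>\<delta>\<in>D. continuous_bounded_semidistance T \<delta>) \<and>
          (\<forall>x\<in>topspace T. \<forall>y\<in>topspace T. d x y = (SUP \<delta>\<in>D. ennreal (\<delta> x y)))) \<and>
     T = topology_generated_by {f -` U \<inter> topspace T | f U. f \<in> Lipb T d \<and> open U}"

definition borel_of :: "'a topology \<Rightarrow> 'a measure" where
  "borel_of T = sigma (topspace T) {U. openin T U}"

definition radon_prob :: "'a topology \<Rightarrow> 'a measure set" where
  "radon_prob T = {\<mu>. prob_space \<mu> \<and> sets \<mu> = sets (borel_of T) \<and>
     (\<forall>B\<in>sets \<mu>. \<forall>\<epsilon>>0. \<exists>K. compactin T K \<and> K \<subseteq> B \<and> measure \<mu> (B - K) < \<epsilon>)}"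

text \<open>Couplings live on the Borel sets of the product topology, which can be strictly more than the
  product of the Borel sigma-algebras.\<close>

definition couplings :: "'a topology \<Rightarrow> 'a measure \<Rightarrow> 'a measure \<Rightarrow> ('a \<times> 'a) measure set" where
  "couplings T \<mu> \<nu> = {\<pi> \<in> radon_prob (prod_topology T T).
     distr \<pi> (borel_of T) fst = \<mu> \<and> distr \<pi> (borel_of T) snd = \<nu>}"

definition ennreal_sqrt :: "ennreal \<Rightarrow> ennreal" where
  "ennreal_sqrt a = (if a = \<top> then \<top> else ennreal (sqrt (enn2real a)))"

definition wasserstein ::
    "'a topology \<Rightarrow> ('a \<Rightarrow> 'a \<Rightarrow> ennreal) \<Rightarrow> 'a measure \<Rightarrow> 'a measure \<Rightarrow> ennreal" where
  "wasserstein T d \<mu> \<nu> =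
     ennreal_sqrt (INF \<pi>\<in>couplings T \<mu> \<nu>. \<integral>\<^sup>+ (x, y). (d x y)\<^sup>2 \<partial>\<pi>)"

definition directed_set :: "'j set \<Rightarrow> ('j \<Rightarrow> 'j \<Rightarrow> bool) \<Rightarrow> bool" where
  "directed_set J le \<longleftrightarrow> J \<noteq> {} \<and> reflp_on J le \<and> transp_on J le \<and>
     (\<forall>i\<in>J. \<forall>j\<in>J. \<exists>k\<in>J. le i k \<and> le j k)"

text \<open>The filter of tails: convergence of a net is convergence along this filter.\<close>

definition net_filter :: "'j set \<Rightarrow> ('j \<Rightarrow> 'j \<Rightarrow> bool) \<Rightarrow> 'j filter" where
  "net_filter J le = (INF j\<in>J. principal {i \<in> J. le j i})"

lemma eventually_net_filter:
  assumes "directed_set J le"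
  shows "eventually P (net_filter J le) \<longleftrightarrow> (\<exists>j\<in>J. \<forall>i\<in>J. le j i \<longrightarrow> P i)"
proof -
  have "J \<noteq> {}" and tr: "transp_on J le"
    and ub: "\<forall>i\<in>J. \<forall>j\<in>J. \<exists>k\<in>J. le i k \<and> le j k"
    using assms unfolding directed_set_def by - (elim conjE, assumption)+
  have "\<exists>k\<in>J. principal {l\<in>J. le k l} \<le> inf (principal {l\<in>J. le i l}) (principal {l\<in>J. le j l})"
    if ij: "i \<in> J" "j \<in> J" for i j
  proof -
    obtain k where k: "k \<in> J" "le i k" "le j k"
      using ub[THEN bspec, OF ij(1), THEN bspec, OF ij(2)] by (elim bexE conjE)
    have "{l\<in>J. le k l} \<subseteq> {l\<in>J. le i l} \<inter> {l\<in>J. le j l}"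
      using transp_onD[OF tr ij(1) k(1) _ k(2)] transp_onD[OF tr ij(2) k(1) _ k(3)] by auto
    then show ?thesis
      by (intro bexI[OF _ k(1)]) (simp only: inf_principal principal_le_iff)
  qed
  from eventually_INF_base[of J "\<lambda>j. principal {i\<in>J. le j i}" P, OF \<open>J \<noteq> {}\<close> this]
  show ?thesis
    by (simp only: net_filter_def eventually_principal Ball_def mem_Collect_eq imp_conjL)
qed

definition weakly_converges ::
    "'a topology \<Rightarrow> ('j \<Rightarrow> 'a measure) \<Rightarrow> 'a measure \<Rightarrow> 'j filter \<Rightarrow> bool" where
  "weakly_converges T \<mu>s \<mu> F \<longleftrightarrow>
     (\<forall>f\<in>Cb T. ((\<lambda>j. \<integral>x. f x \<partial>(\<mu>s j)) \<longlongrightarrow> (\<integral>x. f x \<partial>\<mu>)) F)"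

end

theory Submission
  imports Defs
begin

text \<open>Since \<open>T\<close> is the initial topology of \<open>Lipb T d\<close>, every neighbourhood of a point carries a bump
  function in \<open>Lipb T d\<close>. Given a nonnegative continuous bounded \<open>f\<close> and a compact set of almost full
  \<open>\<mu>\<close>-measure, finitely many scaled bumps have a maximum \<open>g \<in> Lipb T d\<close> that lies below \<open>f\<close> everywhere
  and within \<open>\<epsilon>\<close> of \<open>f\<close> on the compact set, so convergence on \<open>Lipb T d\<close> gives
  \<open>liminf \<integral> f d\<mu>\<^sub>j \<ge> \<integral> f d\<mu>\<close>; applying this to \<open>C + f\<close> and \<open>C - f\<close> gives weak convergence.
  For the Wasserstein part, Jensen's inequality along a coupling gives
  \<open>\<bar>\<integral> f d\<mu> - \<integral> f d\<nu>\<bar> \<le> L W(\<mu>, \<nu>)\<close> for \<open>L\<close>-Lipschitz \<open>f\<close>.\<close>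

section \<open>Closure properties of \<open>Lipb\<close>\<close>

lemma LipbI:
  assumes "continuous_map T euclideanreal f"
    and "\<And>x. x \<in> topspace T \<Longrightarrow> \<bar>f x\<bar> \<le> B"
    and "0 \<le> L"
    and "\<And>x y. x \<in> topspace T \<Longrightarrow> y \<in> topspace T \<Longrightarrow> ennreal \<bar>f x - f y\<bar> \<le> ennreal L * d x y"
  shows "f \<in> Lipb T d"
  unfolding Lipb_def Cb_def bounded_iff using assms by auto

lemma LipbE:
  assumes "f \<in> Lipb T d"
  obtains B L where "continuous_map T euclideanreal f"
    and "\<And>x. x \<in> topspace T \<Longrightarrow> \<bar>f x\<bar> \<le> B"
    and "0 \<le> L"
    and "\<And>x y. x \<in> topspace T \<Longrightarrow> y \<in> topspace T \<Longrightarrow> ennreal \<bar>f x - f y\<bar> \<le> ennreal L * d x y"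
proof -
  from assms obtain B L where "\<forall>y\<in>f ` topspace T. norm y \<le> B" "0 \<le> L" "continuous_map T euclideanreal f"
    "\<forall>x\<in>topspace T. \<forall>y\<in>topspace T. ennreal \<bar>f x - f y\<bar> \<le> ennreal L * d x y"
    unfolding Lipb_def Cb_def bounded_iff by blast
  then show thesis
    by (intro that[of B L]) auto
qed

lemma Lipb_const: "(\<lambda>_. c) \<in> Lipb T d"
  by (rule LipbI[where B = "\<bar>c\<bar>" and L = 0]) auto

text \<open>A Lipschitz function on the whole line is continuous, and comparison with its value at 0
  keeps the composition bounded; the Lipschitz constants multiply. Scaling and the tent function
  used for bumps are both instances.\<close>

lemma Lipb_compose:
  assumes f: "f \<in> Lipb T d" and K: "0 \<le> K" "\<And>s t. \<bar>h s - h t\<bar> \<le> K * \<bar>s - t\<bar>"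
  shows "(\<lambda>x. h (f x)) \<in> Lipb T d"
proof -
  from f obtain B L where c: "continuous_map T euclideanreal f"
    and B: "\<And>x. x \<in> topspace T \<Longrightarrow> \<bar>f x\<bar> \<le> B" and L: "0 \<le> L"
    and l: "\<And>x y. x \<in> topspace T \<Longrightarrow> y \<in> topspace T \<Longrightarrow> ennreal \<bar>f x - f y\<bar> \<le> ennreal L * d x y"
    using LipbE by blast
  have "K-lipschitz_on UNIV h"
    using K by (intro lipschitz_onI) (auto simp: dist_real_def)
  then have "continuous_on UNIV h"
    by (rule lipschitz_on_continuous_on)
  then have "continuous_map T euclideanreal (h \<circ> f)"
    by (intro continuous_map_compose[OF c]) auto
  then have cont: "continuous_map T euclideanreal (\<lambda>x. h (f x))"
    by (simp add: comp_def)
  show ?thesis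
  proof (rule LipbI[OF cont, where B = "\<bar>h 0\<bar> + K * B" and L = "K * L"])
    show "\<bar>h (f x)\<bar> \<le> \<bar>h 0\<bar> + K * B" if "x \<in> topspace T" for x
      using K(2)[of "f x" 0] mult_left_mono[OF B[OF that] K(1)] by auto
    show "0 \<le> K * L" using K L by simp
    fix x y assume xy: "x \<in> topspace T" "y \<in> topspace T"
    have "ennreal \<bar>h (f x) - h (f y)\<bar> \<le> ennreal (K * \<bar>f x - f y\<bar>)"
      by (intro ennreal_leI K)
    also have "\<dots> = ennreal K * ennreal \<bar>f x - f y\<bar>"
      using K by (simp add: ennreal_mult)
    also have "\<dots> \<le> ennreal K * (ennreal L * d x y)"
      by (intro mult_left_mono l xy) simp
    finally show "ennreal \<bar>h (f x) - h (f y)\<bar> \<le> ennreal (K * L) * d x y"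
      using K L by (simp add: ennreal_mult mult.assoc)
  qed
qed

lemma Lipb_max:
  assumes "f \<in> Lipb T d" "g \<in> Lipb T d"
  shows "(\<lambda>x. max (f x) (g x)) \<in> Lipb T d"
proof -
  from assms(1) obtain B L where f: "continuous_map T euclideanreal f"
    "\<And>x. x \<in> topspace T \<Longrightarrow> \<bar>f x\<bar> \<le> B" "0 \<le> L"
    "\<And>x y. x \<in> topspace T \<Longrightarrow> y \<in> topspace T \<Longrightarrow> ennreal \<bar>f x - f y\<bar> \<le> ennreal L * d x y"
    using LipbE by blast
  from assms(2) obtain C M where g: "continuous_map T euclideanreal g"
    "\<And>x. x \<in> topspace T \<Longrightarrow> \<bar>g x\<bar> \<le> C" "0 \<le> M"
    "\<And>x y. x \<in> topspace T \<Longrightarrow> y \<in> topspace T \<Longrightarrow> ennreal \<bar>g x - g y\<bar> \<le> ennreal M * d x y"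
    using LipbE by blast
  show ?thesis
  proof (rule LipbI[where B = "max B C" and L = "L + M"])
    show "continuous_map T euclideanreal (\<lambda>x. max (f x) (g x))"
      by (intro continuous_map_real_max f g)
    show "\<bar>max (f x) (g x)\<bar> \<le> max B C" if "x \<in> topspace T" for x
      using f(2)[OF that] g(2)[OF that] by linarith
    show "0 \<le> L + M" using f g by simp
    fix x y assume xy: "x \<in> topspace T" "y \<in> topspace T"
    \<comment> \<open>The constant \<open>L + M\<close> is cruder than the optimal
      \<open>max L M\<close>, but it splits the estimate into one summand per function.\<close>
    have "ennreal \<bar>max (f x) (g x) - max (f y) (g y)\<bar> \<le> ennreal (\<bar>f x - f y\<bar> + \<bar>g x - g y\<bar>)"
      by (intro ennreal_leI) linarith
    also have "\<dots> = ennreal \<bar>f x - f y\<bar> + ennreal \<bar>g x - g y\<bar>"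
      by simp
    also have "\<dots> \<le> ennreal L * d x y + ennreal M * d x y"
      by (intro add_mono f g xy)
    finally show "ennreal \<bar>max (f x) (g x) - max (f y) (g y)\<bar> \<le> ennreal (L + M) * d x y"
      using f(3) g(3) by (simp add: distrib_right)
  qed
qed

lemma Lipb_scale:
  assumes "f \<in> Lipb T d"
  shows "(\<lambda>x. c * f x) \<in> Lipb T d"
  by (rule Lipb_compose[OF assms, where K = "\<bar>c\<bar>"])
    (auto simp: abs_mult[symmetric] right_diff_distrib)

lemma Lipb_min:
  assumes "f \<in> Lipb T d" "g \<in> Lipb T d"
  shows "(\<lambda>x. min (f x) (g x)) \<in> Lipb T d"
proof -
  have "(\<lambda>x. -1 * max (-1 * f x) (-1 * g x)) \<in> Lipb T d"
    by (intro Lipb_scale Lipb_max assms)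
  moreover have "(\<lambda>x. -1 * max (-1 * f x) (-1 * g x)) = (\<lambda>x. min (f x) (g x))"
    by (auto simp: fun_eq_iff min_def max_def)
  ultimately show ?thesis by simp
qed

section \<open>Bump functions and approximation from below on compact sets\<close>

text \<open>Induction on how V is generated from the subbasis. For a subbasic set a tent function is
  composed with f. For an intersection the minimum of two bumps works, because off the intersection
  one of them vanishes and the other is nonnegative. For a union the bump of a member containing x
  already vanishes outside the union.\<close>

lemma Lipb_bump:
  assumes "T = topology_generated_by {f -` U \<inter> topspace T | f U. f \<in> Lipb T d \<and> open U}"
    and "openin T V" "x \<in> V"
  obtains g where "g \<in> Lipb T d" "\<And>y. 0 \<le> g y" "\<And>y. g y \<le> 1" "g x = 1"
    "\<And>y. y \<in> topspace T \<Longrightarrow> y \<notin> V \<Longrightarrow> g y = 0"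
proof -
  let ?S = "{f -` U \<inter> topspace T | f U. f \<in> Lipb T d \<and> open U}"
  let ?P = "\<lambda>x V. \<exists>g\<in>Lipb T d. (\<forall>y. 0 \<le> g y \<and> g y \<le> 1) \<and> g x = 1 \<and> (\<forall>y\<in>topspace T - V. g y = 0)"
  have "openin (topology_generated_by ?S) V"
    unfolding assms(1)[symmetric] by (rule assms(2))
  then have "generate_topology_on ?S V"
    by (rule openin_topology_generated_by)
  then have "\<forall>x\<in>V. ?P x V"
  proof induction
    case Empty
    show ?case by simp
  next
    case (Int V W)
    show ?case
    proof
      fix x assume x: "x \<in> V \<inter> W"
      obtain g where g: "g \<in> Lipb T d" "\<forall>y. 0 \<le> g y \<and> g y \<le> 1" "g x = 1" "\<forall>y\<in>topspace T - V. g y = 0"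
        using Int x by blast
      obtain h where h: "h \<in> Lipb T d" "\<forall>y. 0 \<le> h y \<and> h y \<le> 1" "h x = 1" "\<forall>y\<in>topspace T - W. h y = 0"
        using Int x by blast
      show "?P x (V \<inter> W)"
        by (rule bexI[OF _ Lipb_min[OF g(1) h(1)]])
          (use g h in \<open>auto simp: min_def antisym\<close>)
    qed
  next
    case (UN \<V>)
    show ?case
    proof
      fix x assume "x \<in> \<Union>\<V>"
      then obtain V where V: "V \<in> \<V>" "x \<in> V" by blast
      with UN obtain g where "g \<in> Lipb T d" "\<forall>y. 0 \<le> g y \<and> g y \<le> 1" "g x = 1" "\<forall>y\<in>topspace T - V. g y = 0"
        by blast
      with V show "?P x (\<Union>\<V>)" by (intro bexI[of _ g]) auto
    qed
  next
    case (Basis V)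
    then obtain f U where V: "V = f -` U \<inter> topspace T" "f \<in> Lipb T d" "open U" by blast
    show ?case
    proof
      fix x assume "x \<in> V"
      then have "f x \<in> U" using V by auto
      then obtain r where r: "r > 0" "ball (f x) r \<subseteq> U"
        using \<open>open U\<close> open_contains_ball by blast
      \<comment> \<open>The tent of height 1 centred at \<open>f x\<close>: it vanishes at distance
        at least r from \<open>f x\<close>, hence at every value of f outside U, and it has slope
        \<open>1 / r\<close>.\<close>
      let ?h = "\<lambda>t. max 0 (1 - (1 / r) * \<bar>t - f x\<bar>)"
      have lip: "\<bar>?h s - ?h t\<bar> \<le> (1 / r) * \<bar>s - t\<bar>" for s t
      proof -
        have "\<bar>?h s - ?h t\<bar> \<le> \<bar>(1 / r) * \<bar>s - f x\<bar> - (1 / r) * \<bar>t - f x\<bar>\<bar>"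
          by linarith
        also have "\<dots> = (1 / r) * \<bar>\<bar>s - f x\<bar> - \<bar>t - f x\<bar>\<bar>"
          using r by (simp add: abs_mult[symmetric] right_diff_distrib[symmetric] diff_divide_distrib[symmetric])
        also have "\<dots> \<le> (1 / r) * \<bar>s - t\<bar>"
          using r by (intro mult_left_mono) auto
        finally show ?thesis .
      qed
      have "(\<lambda>y. ?h (f y)) \<in> Lipb T d"
        using r by (intro Lipb_compose[OF V(2) _ lip]) auto
      moreover have "?h (f y) = 0" if "y \<in> topspace T - V" for y
      proof -
        have "f y \<notin> ball (f x) r" using that V r by auto
        then show ?thesis using r by (auto simp: dist_real_def field_simps abs_minus_commute)
      qed
      ultimately show "?P x V"
        using r by (intro bexI[of _ "\<lambda>y. ?h (f y)"]) auto
    qed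
  qed
  then show thesis using that assms(3) by (metis DiffI)
qed

text \<open>The maximum of the members of G and the constant 0. Starting the induction at 0 covers
  the empty family and makes h nonnegative; \<open>0 \<le> f x\<close> keeps this start below
  f.\<close>

lemma Lipb_finite_upper_bound:
  assumes "finite G" "\<And>g. g \<in> G \<Longrightarrow> g \<in> Lipb T d"
    and "\<And>g x. g \<in> G \<Longrightarrow> x \<in> topspace T \<Longrightarrow> g x \<le> f x"
    and "\<And>x. x \<in> topspace T \<Longrightarrow> (0::real) \<le> f x"
  obtains h where "h \<in> Lipb T d" "\<And>x. 0 \<le> h x" "\<And>x. x \<in> topspace T \<Longrightarrow> h x \<le> f x"
    "\<And>g x. g \<in> G \<Longrightarrow> x \<in> topspace T \<Longrightarrow> g x \<le> h x"
proof -
  have "\<exists>h\<in>Lipb T d. (\<forall>x. 0 \<le> h x) \<and> (\<forall>x\<in>topspace T. h x \<le> f x) \<and> (\<forall>g\<in>G. \<forall>x\<in>topspace T. g x \<le> h x)"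
    using assms(1,2,3)
  proof (induction G rule: finite_induct)
    case empty
    show ?case by (rule bexI[OF _ Lipb_const[of 0]]) (use assms(4) in auto)
  next
    case (insert g G)
    then obtain h where h: "h \<in> Lipb T d" "\<forall>x. 0 \<le> h x" "\<forall>x\<in>topspace T. h x \<le> f x"
      "\<forall>g\<in>G. \<forall>x\<in>topspace T. g x \<le> h x" by blast
    show ?case
      by (rule bexI[OF _ Lipb_max[OF h(1), of g]]) (use insert h in \<open>auto simp: le_max_iff_disj\<close>)
  qed
  then show thesis using that by blast
qed

text \<open>A scaled bump at x stays below f and is close to f near x. Compactness of K leaves
  finitely many centres, and the maximum of their bumps stays below f while being close to f on all
  of K.\<close>

lemma Lipb_approx_below:
  assumes gen: "T = topology_generated_by {f -` U \<inter> topspace T | f U. f \<in> Lipb T d \<and> open U}"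
    and f: "continuous_map T euclideanreal f" "\<And>x. x \<in> topspace T \<Longrightarrow> 0 \<le> f x"
    and K: "compactin T K" and "0 < \<epsilon>"
  obtains g where "g \<in> Lipb T d" "\<And>x. 0 \<le> g x" "\<And>x. x \<in> topspace T \<Longrightarrow> g x \<le> f x"
    "\<And>x. x \<in> K \<Longrightarrow> f x - \<epsilon> \<le> g x"
proof -
  have KT: "K \<subseteq> topspace T" using K by (rule compactin_subset_topspace)
  have "\<exists>g. g \<in> Lipb T d \<and> (\<forall>y\<in>topspace T. g y \<le> f y) \<and> f x - g x < \<epsilon>" if "x \<in> K" for x
  proof -
    have x: "x \<in> topspace T" using that KT by auto
    \<comment> \<open>On V the function f exceeds \<open>f x - \<epsilon> / 2\<close> and is
      nonnegative, so c is below f there. Truncation at 0 makes c nonnegative, so that a bump with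
      values in [0,1] scaled by c stays below c. At x the loss is at most
      \<open>\<epsilon> / 2\<close>, which leaves room for a strict inequality.\<close>
    define c where "c = max 0 (f x - \<epsilon> / 2)"
    define V where "V = {y \<in> topspace T. f y \<in> {f x - \<epsilon> / 2 <..}}"
    have V: "openin T V" "x \<in> V"
      unfolding V_def using x \<open>0 < \<epsilon>\<close> openin_continuous_map_preimage[OF f(1), of "{f x - \<epsilon> / 2 <..}"]
      by auto
    obtain b where b: "b \<in> Lipb T d" "\<And>y. 0 \<le> b y" "\<And>y. b y \<le> 1" "b x = 1"
      "\<And>y. y \<in> topspace T \<Longrightarrow> y \<notin> V \<Longrightarrow> b y = 0"
      using Lipb_bump[OF gen V] by metis
    let ?g = "\<lambda>y. c * b y"
    have g: "?g \<in> Lipb T d" by (intro Lipb_scale b)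
    have le: "?g y \<le> f y" if "y \<in> topspace T" for y
    proof (cases "y \<in> V")
      case True
      have "?g y \<le> c" using b(3)[of y] by (intro mult_left_le) (auto simp: c_def)
      also have "c \<le> f y" using True f(2)[OF that] by (auto simp: V_def c_def)
      finally show ?thesis .
    qed (use b that f in auto)
    have "f x - ?g x < \<epsilon>"
      using \<open>0 < \<epsilon>\<close> by (simp add: b c_def max_def)
    then show ?thesis
      using g le by blast
  qed
  then have "\<exists>G. \<forall>x\<in>K. G x \<in> Lipb T d \<and> (\<forall>y\<in>topspace T. G x y \<le> f y) \<and> f x - G x x < \<epsilon>"
    by (intro bchoice) blast
  then obtain G where G: "\<And>x. x \<in> K \<Longrightarrow> G x \<in> Lipb T d"
    "\<And>x y. x \<in> K \<Longrightarrow> y \<in> topspace T \<Longrightarrow> G x y \<le> f y" "\<And>x. x \<in> K \<Longrightarrow> f x - G x x < \<epsilon>"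
    by blast
  \<comment> \<open>Since \<open>f x - G x x < \<epsilon>\<close> is strict, it persists on an open
    neighbourhood of x with the same function \<open>G x\<close>. These neighbourhoods form the
    cover to which compactness is applied.\<close>
  define V where "V x = {y \<in> topspace T. f y - G x y \<in> {..<\<epsilon>}}" for x
  have V: "openin T (V x)" "x \<in> V x" if x: "x \<in> K" for x
  proof -
    have "continuous_map T euclideanreal (\<lambda>y. f y - G x y)"
      using G(1)[OF x] by (intro continuous_map_diff f) (auto simp: Lipb_def Cb_def)
    then show "openin T (V x)"
      unfolding V_def by (rule openin_continuous_map_preimage) simp
    show "x \<in> V x"
      using x KT G(3) by (auto simp: V_def)
  qed
  have "\<forall>U\<in>V ` K. openin T U" "K \<subseteq> \<Union>(V ` K)"
    using V by auto
  then have "\<exists>\<F>. finite \<F> \<and> \<F> \<subseteq> V ` K \<and> K \<subseteq> \<Union>\<F>"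
    using K unfolding compactin_def by (elim conjE allE[of _ "V ` K"]) blast
  then obtain F where F: "finite F" "F \<subseteq> K" "K \<subseteq> \<Union>(V ` F)"
    by (metis finite_subset_image)
  obtain h where h: "h \<in> Lipb T d" "\<And>x. 0 \<le> h x" "\<And>x. x \<in> topspace T \<Longrightarrow> h x \<le> f x"
    "\<And>g x. g \<in> G ` F \<Longrightarrow> x \<in> topspace T \<Longrightarrow> g x \<le> h x"
    by (rule Lipb_finite_upper_bound[of "G ` F" T d f]) (use F G f(2) in auto)
  have "f x - \<epsilon> \<le> h x" if x: "x \<in> K" for x
  proof -
    obtain z where z: "z \<in> F" "x \<in> V z" using F x by auto
    then have "f x - \<epsilon> < G z x" by (auto simp: V_def)
    also have "G z x \<le> h x" using h(4)[of "G z" x] z KT x by auto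
    finally show ?thesis by simp
  qed
  with h show thesis using that by blast
qed

section \<open>Borel measurability and integrability for Radon measures\<close>

lemma sets_borel_of: "sets (borel_of T) = sigma_sets (topspace T) {U. openin T U}"
  unfolding borel_of_def by (rule sets_measure_of) (auto dest: openin_subset)

lemma space_borel_of: "space (borel_of T) = topspace T"
  unfolding borel_of_def by (rule space_measure_of) (auto dest: openin_subset)

lemma radon_probD:
  assumes "\<mu> \<in> radon_prob T"
  shows "prob_space \<mu>" "sets \<mu> = sets (borel_of T)" "space \<mu> = topspace T"
  using assms sets_eq_imp_space_eq[of \<mu> "borel_of T"]
  unfolding radon_prob_def by (auto simp: space_borel_of)

lemma continuous_map_measurable_borel_of:
  assumes "continuous_map S T f"
  shows "f \<in> measurable (borel_of S) (borel_of T)"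
proof -
  have "f -` U \<inter> topspace S \<in> sets (borel_of S)" if "openin T U" for U
    unfolding sets_borel_of
    using openin_continuous_map_preimage[OF assms that]
    by (intro sigma_sets.Basic) (auto simp: vimage_def Int_def conj_commute)
  then show ?thesis
    unfolding borel_of_def[of T]
    by (intro measurable_measure_of)
      (use continuous_map_image_subset_topspace[OF assms] in \<open>auto dest: openin_subset simp: space_borel_of\<close>)
qed

lemma Cb_measurable:
  assumes "f \<in> Cb T" "sets \<mu> = sets (borel_of T)"
  shows "f \<in> borel_measurable \<mu>"
proof -
  have "borel_of euclideanreal = (borel :: real measure)"
    by (simp add: borel_of_def borel_def)
  then show ?thesis
    using continuous_map_measurable_borel_of[of T euclideanreal f] assms
    by (simp add: Cb_def cong: measurable_cong_sets)
qed

lemma CbE: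
  assumes "f \<in> Cb T"
  obtains C where "0 \<le> C" "\<And>x. x \<in> topspace T \<Longrightarrow> \<bar>f x\<bar> \<le> C"
proof -
  from assms obtain C where "\<forall>y\<in>f ` topspace T. norm y \<le> C"
    unfolding Cb_def bounded_iff by blast
  \<comment> \<open>On an empty carrier the bound C could be negative, so it is replaced by
    \<open>max 0 C\<close>.\<close>
  then show thesis by (intro that[of "max 0 C"]) (auto simp: le_max_iff_disj)
qed

lemma Cb_integrable:
  assumes f: "f \<in> Cb T" and \<mu>: "\<mu> \<in> radon_prob T"
  shows "integrable \<mu> f"
proof -
  interpret prob_space \<mu> using radon_probD(1)[OF \<mu>] .
  obtain C where "\<And>x. x \<in> topspace T \<Longrightarrow> \<bar>f x\<bar> \<le> C" using CbE[OF f] by blast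
  then show ?thesis
    by (intro integrable_const_bound[of _ C] Cb_measurable[OF f] AE_I2)
      (use radon_probD[OF \<mu>] in auto)
qed

lemma Lipb_subset_Cb: "Lipb T d \<subseteq> Cb T"
  by (auto simp: Lipb_def)

section \<open>From test functions in \<open>Lipb\<close> to weak convergence\<close>

text \<open>Inner regularity of \<mu> on the whole space gives a compact K whose complement has mass
  below \<delta>. On K the function g loses at most \<open>\<epsilon> / 2\<close>; off K it loses at
  most C, since g is nonnegative and f is at most C.\<close>

lemma Lipb_integral_approx_below:
  assumes gen: "T = topology_generated_by {f -` U \<inter> topspace T | f U. f \<in> Lipb T d \<and> open U}"
    and H: "Hausdorff_space T"
    and f: "f \<in> Cb T" "\<And>x. x \<in> topspace T \<Longrightarrow> 0 \<le> f x"
    and \<mu>: "\<mu> \<in> radon_prob T" and e: "0 < \<epsilon>"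
  obtains g where "g \<in> Lipb T d" "\<And>x. x \<in> topspace T \<Longrightarrow> g x \<le> f x"
    "(\<integral>x. f x \<partial>\<mu>) - \<epsilon> < (\<integral>x. g x \<partial>\<mu>)"
proof -
  interpret prob_space \<mu> using radon_probD(1)[OF \<mu>] .
  note sp = radon_probD(3)[OF \<mu>]
  obtain C where C: "0 \<le> C" "\<And>x. x \<in> topspace T \<Longrightarrow> \<bar>f x\<bar> \<le> C" using CbE[OF f(1)] by blast
  \<comment> \<open>Chosen so that \<open>C * \<delta> < \<epsilon> / 2\<close>; the summand 1 keeps
    the denominator positive when C is 0.\<close>
  define \<delta> where "\<delta> = \<epsilon> / (2 * (C + 1))"
  have "0 < \<delta>" using e C by (simp add: \<delta>_def)
  moreover have "topspace T \<in> sets \<mu>" using sets.top[of \<mu>] sp by simp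
  ultimately obtain K where K: "compactin T K" "measure \<mu> (topspace T - K) < \<delta>"
    using \<mu> unfolding radon_prob_def by blast
  obtain g where g: "g \<in> Lipb T d" "\<And>x. 0 \<le> g x" "\<And>x. x \<in> topspace T \<Longrightarrow> g x \<le> f x"
    "\<And>x. x \<in> K \<Longrightarrow> f x - \<epsilon> / 2 \<le> g x"
    using Lipb_approx_below[where f = f and \<epsilon> = "\<epsilon> / 2", OF gen _ f(2) K(1)] f(1) e unfolding Cb_def by auto
  have int: "integrable \<mu> f" "integrable \<mu> g"
    using f(1) g(1) Lipb_subset_Cb \<mu> by (blast intro: Cb_integrable)+
  \<comment> \<open>The Hausdorff property makes the compact set K closed, so its complement is
    Borel.\<close>
  have "openin T (topspace T - K)"
    using compactin_imp_closedin[OF H K(1)] by blast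
  then have N: "topspace T - K \<in> sets \<mu>"
    using radon_probD(2)[OF \<mu>] by (auto simp: sets_borel_of)
  have "(\<integral>x. f x \<partial>\<mu>) - (\<integral>x. g x \<partial>\<mu>) = (\<integral>x. f x - g x \<partial>\<mu>)"
    using int by simp
  also have "\<dots> \<le> (\<integral>x. \<epsilon> / 2 + C * indicator (topspace T - K) x \<partial>\<mu>)"
  proof (rule integral_mono)
    show "integrable \<mu> (\<lambda>x. f x - g x)" using int by simp
    show "integrable \<mu> (\<lambda>x. \<epsilon> / 2 + C * indicator (topspace T - K) x)"
      using N by (intro Bochner_Integration.integrable_add integrable_mult_right) (auto simp: emeasure_eq_measure)
    show "f x - g x \<le> \<epsilon> / 2 + C * indicator (topspace T - K) x" if "x \<in> space \<mu>" for x
      using that g(2)[of x] g(4)[of x] C(2)[of x] e by (cases "x \<in> K") (auto simp: sp)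
  qed
  also have "\<dots> = \<epsilon> / 2 + C * measure \<mu> (topspace T - K)"
    using N by (subst Bochner_Integration.integral_add) (auto simp: emeasure_eq_measure prob_space)
  also have "\<dots> \<le> \<epsilon> / 2 + C * \<delta>"
    using K C by (intro add_left_mono mult_left_mono) auto
  also have "\<dots> < \<epsilon>"
    using C e by (simp add: \<delta>_def field_simps add_pos_nonneg)
  finally show thesis
    using that g by (simp add: algebra_simps)
qed

text \<open>Lower bounds for nonnegative functions suffice, because both \<open>C + f\<close> and
  \<open>C - f\<close> are nonnegative and integrate to affine expressions in the integral of f. The
  Radon condition is asked only eventually, since a filter of tails controls only indices in
  J.\<close>

lemma weakly_converges_if_Lipb:
  assumes gen: "T = topology_generated_by {f -` U \<inter> topspace T | f U. f \<in> Lipb T d \<and> open U}"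
    and H: "Hausdorff_space T"
    and \<mu>s: "eventually (\<lambda>j. \<mu>s j \<in> radon_prob T) F" and \<mu>: "\<mu> \<in> radon_prob T"
    and conv: "\<And>f. f \<in> Lipb T d \<Longrightarrow> ((\<lambda>j. \<integral>x. f x \<partial>(\<mu>s j)) \<longlongrightarrow> (\<integral>x. f x \<partial>\<mu>)) F"
  shows "weakly_converges T \<mu>s \<mu> F"
proof -
  \<comment> \<open>The minorant g is chosen from \<mu>, f and \<epsilon> before any index j. Its
    integrals eventually exceed the threshold, and g being below f passes this on to the integrals
    of f.\<close>
  have below: "eventually (\<lambda>j. (\<integral>x. f x \<partial>\<mu>) - \<epsilon> < (\<integral>x. f x \<partial>(\<mu>s j))) F"
    if f: "f \<in> Cb T" "\<And>x. x \<in> topspace T \<Longrightarrow> 0 \<le> f x" and e: "0 < \<epsilon>" for f \<epsilon>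
  proof -
    obtain g where g: "g \<in> Lipb T d" "\<And>x. x \<in> topspace T \<Longrightarrow> g x \<le> f x"
      "(\<integral>x. f x \<partial>\<mu>) - \<epsilon> < (\<integral>x. g x \<partial>\<mu>)"
      using Lipb_integral_approx_below[OF gen H f \<mu> e] by blast
    show ?thesis
      using order_tendstoD(1)[OF conv[OF g(1)] g(3)] \<mu>s
    proof eventually_elim
      case (elim j)
      have "(\<integral>x. g x \<partial>(\<mu>s j)) \<le> (\<integral>x. f x \<partial>(\<mu>s j))"
        using elim f g subsetD[OF Lipb_subset_Cb g(1)] radon_probD(3)[OF elim(2)]
        by (intro integral_mono Cb_integrable[of _ T]) auto
      with elim show ?case by linarith
    qed
  qed
  show ?thesis
    unfolding weakly_converges_def
  proof
    fix f assume f: "f \<in> Cb T"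
    then obtain C where C: "\<And>x. x \<in> topspace T \<Longrightarrow> \<bar>f x\<bar> \<le> C" using CbE by blast
    \<comment> \<open>Stated for a general factor s so that the cases s = 1 and s = -1 below share
      it.\<close>
    have shift: "(\<lambda>x. C + s * f x) \<in> Cb T"
      "\<nu> \<in> radon_prob T \<Longrightarrow> (\<integral>x. C + s * f x \<partial>\<nu>) = C + s * (\<integral>x. f x \<partial>\<nu>)" for s \<nu>
    proof -
      have "\<bar>C + s * f x\<bar> \<le> \<bar>C\<bar> + \<bar>s\<bar> * C" if "x \<in> topspace T" for x
        using abs_triangle_ineq[of C "s * f x"] mult_left_mono[OF C[OF that] abs_ge_zero[of s]]
        by (simp add: abs_mult)
      then have "bounded ((\<lambda>x. C + s * f x) ` topspace T)"
        unfolding bounded_iff by auto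
      then show "(\<lambda>x. C + s * f x) \<in> Cb T"
        using f unfolding Cb_def
        by (auto intro!: continuous_map_add continuous_map_real_mult_left)
      assume \<nu>: "\<nu> \<in> radon_prob T"
      interpret prob_space \<nu> using radon_probD(1)[OF \<nu>] .
      show "(\<integral>x. C + s * f x \<partial>\<nu>) = C + s * (\<integral>x. f x \<partial>\<nu>)"
        using Cb_integrable[OF f \<nu>] by (simp add: prob_space)
    qed
    show "((\<lambda>j. \<integral>x. f x \<partial>(\<mu>s j)) \<longlongrightarrow> (\<integral>x. f x \<partial>\<mu>)) F"
    proof (rule tendstoI)
      fix \<epsilon> :: real assume e: "0 < \<epsilon>"
      have "eventually (\<lambda>j. (\<integral>x. C + 1 * f x \<partial>\<mu>) - \<epsilon> < (\<integral>x. C + 1 * f x \<partial>(\<mu>s j))) F"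
        by (rule below[OF shift(1) _ e]) (use C in force)
      moreover have "eventually (\<lambda>j. (\<integral>x. C + (-1) * f x \<partial>\<mu>) - \<epsilon> < (\<integral>x. C + (-1) * f x \<partial>(\<mu>s j))) F"
        by (rule below[OF shift(1) _ e]) (use C in force)
      ultimately show "eventually (\<lambda>j. dist (\<integral>x. f x \<partial>(\<mu>s j)) (\<integral>x. f x \<partial>\<mu>) < \<epsilon>) F"
        using \<mu>s
      proof eventually_elim
        case (elim j)
        from elim(1,2) show ?case
          unfolding shift(2)[OF elim(3)] shift(2)[OF \<mu>] dist_real_def by linarith
      qed
    qed
  qed
qed

section \<open>Wasserstein distance controls integrals of Lipschitz functions\<close>

text \<open>Jensen's inequality for the square, read off from nonnegativity of the variance.\<close>

lemma (in prob_space) square_expectation_le: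
  fixes h :: "'a \<Rightarrow> real"
  assumes "integrable M h" "integrable M (\<lambda>x. (h x)\<^sup>2)"
  shows "(expectation h)\<^sup>2 \<le> expectation (\<lambda>x. (h x)\<^sup>2)"
  using variance_eq[OF assms] variance_positive[of h] by simp

text \<open>The function \<open>h (x, y) = (f x - f y) / L\<close> has absolute value at most
  \<open>d x y\<close>, and by the marginal conditions its expectation is the difference of the
  integrals divided by L. Jensen then bounds the squared expectation by the cost. The last
  comparison is pointwise monotonicity, valid for \<open>nn_integral\<close> of arbitrary
  functions.\<close>

lemma Lipb_integral_diff_le_cost:
  assumes \<pi>: "\<pi> \<in> couplings T \<mu> \<nu>" and f: "f \<in> Cb T" and L: "0 < L"
    and lip: "\<And>x y. x \<in> topspace T \<Longrightarrow> y \<in> topspace T \<Longrightarrow> ennreal \<bar>f x - f y\<bar> \<le> ennreal L * d x y"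
  shows "ennreal ((\<bar>(\<integral>x. f x \<partial>\<mu>) - (\<integral>x. f x \<partial>\<nu>)\<bar> / L)\<^sup>2) \<le> (\<integral>\<^sup>+ (x, y). (d x y)\<^sup>2 \<partial>\<pi>)"
proof -
  have \<pi>r: "\<pi> \<in> radon_prob (prod_topology T T)" and
    marg: "\<mu> = distr \<pi> (borel_of T) fst" "\<nu> = distr \<pi> (borel_of T) snd"
    using \<pi> by (auto simp: couplings_def)
  interpret prob_space \<pi> using radon_probD(1)[OF \<pi>r] .
  note sp = radon_probD(3)[OF \<pi>r]
  \<comment> \<open>The coupling lives on the Borel sets of the product topology, so the projections
    are measurable because they are continuous.\<close>
  have [measurable]: "fst \<in> measurable \<pi> (borel_of T)" "snd \<in> measurable \<pi> (borel_of T)"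
    using continuous_map_measurable_borel_of[OF continuous_map_fst[of T T]]
      continuous_map_measurable_borel_of[OF continuous_map_snd[of T T]] radon_probD(2)[OF \<pi>r]
    by (simp_all cong: measurable_cong_sets)
  have [measurable]: "f \<in> borel_measurable (borel_of T)" by (rule Cb_measurable[OF f refl])
  obtain C where C: "0 \<le> C" "\<And>x. x \<in> topspace T \<Longrightarrow> \<bar>f x\<bar> \<le> C" using CbE[OF f] by blast
  define h where "h = (\<lambda>z. (f (fst z) - f (snd z)) / L)"
  have [measurable]: "h \<in> borel_measurable \<pi>" unfolding h_def by measurable
  have int: "integrable \<pi> (\<lambda>z. f (fst z))" "integrable \<pi> (\<lambda>z. f (snd z))"
    by (intro integrable_const_bound[of _ C] AE_I2; use C sp in \<open>auto\<close>)+
  have hb: "\<bar>h z\<bar> \<le> 2 * C / L" if "z \<in> space \<pi>" for z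
    using C(2)[of "fst z"] C(2)[of "snd z"] that L
    by (auto simp: sp h_def abs_divide divide_le_cancel)
  have hb2: "(h z)\<^sup>2 \<le> (2 * C / L)\<^sup>2" if "z \<in> space \<pi>" for z
    using power_mono[OF hb[OF that] abs_ge_zero, of 2] by simp
  have ih1: "integrable \<pi> h"
    by (rule integrable_const_bound[of _ "2 * C / L"]) (auto intro!: AE_I2 hb)
  have ih2: "integrable \<pi> (\<lambda>z. (h z)\<^sup>2)"
    by (rule integrable_const_bound[of _ "(2 * C / L)\<^sup>2"]) (auto intro!: AE_I2 hb2)
  have "(\<integral>x. f x \<partial>\<mu>) - (\<integral>x. f x \<partial>\<nu>) = (\<integral>z. f (fst z) \<partial>\<pi>) - (\<integral>z. f (snd z) \<partial>\<pi>)"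
    unfolding marg by (simp add: integral_distr)
  then have "(\<bar>(\<integral>x. f x \<partial>\<mu>) - (\<integral>x. f x \<partial>\<nu>)\<bar> / L)\<^sup>2 = (expectation h)\<^sup>2"
    using int by (simp add: h_def power_divide)
  also have "\<dots> \<le> expectation (\<lambda>z. (h z)\<^sup>2)"
    by (rule square_expectation_le[OF ih1 ih2])
  finally have "ennreal ((\<bar>(\<integral>x. f x \<partial>\<mu>) - (\<integral>x. f x \<partial>\<nu>)\<bar> / L)\<^sup>2) \<le> ennreal (expectation (\<lambda>z. (h z)\<^sup>2))"
    by (rule ennreal_leI)
  also have "\<dots> = (\<integral>\<^sup>+ z. ennreal ((h z)\<^sup>2) \<partial>\<pi>)"
    by (rule nn_integral_eq_integral[symmetric, OF ih2]) simp
  also have "\<dots> \<le> (\<integral>\<^sup>+ (x, y). (d x y)\<^sup>2 \<partial>\<pi>)"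
  proof (rule nn_integral_mono)
    fix z assume "z \<in> space \<pi>"
    then obtain x y where z: "z = (x, y)" and xy: "x \<in> topspace T" "y \<in> topspace T"
      by (auto simp: sp)
    \<comment> \<open>At infinite distance the right-hand side is infinite; at finite distance the
      Lipschitz bound becomes an inequality between reals.\<close>
    have "ennreal ((h z)\<^sup>2) \<le> (d x y)\<^sup>2"
    proof (cases "d x y")
      case (real r)
      then have "ennreal \<bar>f x - f y\<bar> \<le> ennreal (L * r)"
        using lip[OF xy] L by (simp add: ennreal_mult)
      then have "\<bar>f x - f y\<bar> \<le> L * r" using real L by (simp add: ennreal_le_iff)
      then have "\<bar>h z\<bar> \<le> r" using L by (simp add: h_def z abs_divide field_simps)
      then have "(h z)\<^sup>2 \<le> r\<^sup>2" using power_mono[of "\<bar>h z\<bar>" r 2] by simp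
      then show ?thesis using real by (simp add: ennreal_power ennreal_leI)
    qed (simp add: power2_eq_square ennreal_top_mult)
    then show "ennreal ((h z)\<^sup>2) \<le> (case z of (x, y) \<Rightarrow> (d x y)\<^sup>2)" by (simp add: z)
  qed
  finally show ?thesis .
qed

text \<open>Turns a bound on the squared scale, valid for the infimum of the costs, into a bound on
  the Wasserstein distance itself.\<close>

lemma ennreal_le_ennreal_sqrt:
  assumes "ennreal (a\<^sup>2) \<le> b" "0 \<le> a"
  shows "ennreal a \<le> ennreal_sqrt b"
proof (cases b)
  case (real r)
  then have "a \<le> sqrt r" using assms by (auto intro: real_le_rsqrt)
  then show ?thesis using real by (simp add: ennreal_sqrt_def ennreal_leI)
qed (simp add: ennreal_sqrt_def)

text \<open>The preceding cost bound holds for each coupling, hence for the infimum. Without any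
  coupling the infimum is infinite and the bound is trivial.\<close>

lemma Lipb_integral_diff_le_wasserstein:
  assumes "f \<in> Cb T" and L: "0 < L"
    and "\<And>x y. x \<in> topspace T \<Longrightarrow> y \<in> topspace T \<Longrightarrow> ennreal \<bar>f x - f y\<bar> \<le> ennreal L * d x y"
  shows "ennreal (\<bar>(\<integral>x. f x \<partial>\<mu>) - (\<integral>x. f x \<partial>\<nu>)\<bar> / L) \<le> wasserstein T d \<mu> \<nu>"
  unfolding wasserstein_def
  by (intro ennreal_le_ennreal_sqrt INF_greatest Lipb_integral_diff_le_cost[OF _ assms]) (use L in auto)

lemma Lipb_tendsto_if_wasserstein:
  assumes W: "((\<lambda>j. wasserstein T d (\<mu>s j) \<mu>) \<longlongrightarrow> 0) F" and f: "f \<in> Lipb T d"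
  shows "((\<lambda>j. \<integral>x. f x \<partial>(\<mu>s j)) \<longlongrightarrow> (\<integral>x. f x \<partial>\<mu>)) F"
proof (rule tendstoI)
  fix \<epsilon> :: real assume e: "0 < \<epsilon>"
  from f obtain L where L: "0 \<le> L"
    and l: "\<And>x y. x \<in> topspace T \<Longrightarrow> y \<in> topspace T \<Longrightarrow> ennreal \<bar>f x - f y\<bar> \<le> ennreal L * d x y"
    by (rule LipbE) blast
  \<comment> \<open>Enlarging the constant to \<open>L + 1\<close> makes it positive, so that it can
    be divided by even when L is 0.\<close>
  have l': "ennreal \<bar>f x - f y\<bar> \<le> ennreal (L + 1) * d x y" if "x \<in> topspace T" "y \<in> topspace T" for x y
    by (rule order_trans[OF l[OF that]]) (intro mult_right_mono ennreal_leI, auto)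
  have fC: "f \<in> Cb T" using f Lipb_subset_Cb by blast
  have "0 < ennreal (\<epsilon> / (L + 1))" using e L by simp
  from order_tendstoD(2)[OF W this]
  show "eventually (\<lambda>j. dist (\<integral>x. f x \<partial>(\<mu>s j)) (\<integral>x. f x \<partial>\<mu>) < \<epsilon>) F"
  proof eventually_elim
    case (elim j)
    have "ennreal (\<bar>(\<integral>x. f x \<partial>(\<mu>s j)) - (\<integral>x. f x \<partial>\<mu>)\<bar> / (L + 1)) < ennreal (\<epsilon> / (L + 1))"
      using L by (intro le_less_trans[OF Lipb_integral_diff_le_wasserstein[OF fC _ l'] elim]) auto
    then show ?case
      using L e by (simp add: ennreal_less_iff dist_real_def divide_less_cancel)
  qed
qed

theorem proposition5p2:
  fixes T :: "'a topology" and d :: "'a \<Rightarrow> 'a \<Rightarrow> ennreal"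
    and J :: "'j set" and le :: "'j \<Rightarrow> 'j \<Rightarrow> bool"
    and \<mu>s :: "'j \<Rightarrow> 'a measure" and \<mu> :: "'a measure"
  assumes "extended_metric_topological_space T d"
    and "directed_set J le"
    and "\<And>j. j \<in> J \<Longrightarrow> \<mu>s j \<in> radon_prob T"
    and "\<mu> \<in> radon_prob T"
  shows "(weakly_converges T \<mu>s \<mu> (net_filter J le) \<longleftrightarrow>
           (\<forall>f\<in>Lipb T d.
              ((\<lambda>j. \<integral>x. f x \<partial>(\<mu>s j)) \<longlongrightarrow> (\<integral>x. f x \<partial>\<mu>)) (net_filter J le)))
       \<and> (((\<lambda>j. wasserstein T d (\<mu>s j) \<mu>) \<longlongrightarrow> 0) (net_filter J le) \<longrightarrow>
            weakly_converges T \<mu>s \<mu> (net_filter J le))"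
proof -
  have H: "Hausdorff_space T"
    and gen: "T = topology_generated_by {f -` U \<inter> topspace T | f U. f \<in> Lipb T d \<and> open U}"
    using assms(1) unfolding extended_metric_topological_space_def by - (elim conjE, assumption)+
  \<comment> \<open>Any single index of J provides a tail on which all measures are Radon.\<close>
  have "J \<noteq> {}" using assms(2) by (simp add: directed_set_def)
  then have ev: "eventually (\<lambda>j. \<mu>s j \<in> radon_prob T) (net_filter J le)"
    using assms(3) by (auto simp: eventually_net_filter[OF assms(2)])
  note conv = weakly_converges_if_Lipb[OF gen H ev assms(4)]
  show ?thesis
  proof (intro conjI iffI impI ballI)
    fix f assume "weakly_converges T \<mu>s \<mu> (net_filter J le)" "f \<in> Lipb T d"
    then show "((\<lambda>j. \<integral>x. f x \<partial>(\<mu>s j)) \<longlongrightarrow> (\<integral>x. f x \<partial>\<mu>)) (net_filter J le)"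
      unfolding weakly_converges_def using Lipb_subset_Cb by blast
  qed (blast intro: conv Lipb_tendsto_if_wasserstein)+
qed

end
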